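(* Let $x>1$, let $n\ge 0$ be an integer and let $k\in\{1,2,\dots,n\}$. Then $$c_k(n+1,x)=\frac{1-x}{2}\,c_{k-1}(n,x)+\frac{1+x}{2}\,c_k(n,x).$$
   Context: For integers $0\le k\le n$, the superoscillatory coefficients are $c_k(n,x)=\binom{n}{k}\left(\frac{1+x}{2}\right)^{n-k}\left(\frac{1-x}{2}\right)^{k}$. *)

theory Defs
  imports Complex_Main
begin

text \<open>
  The superoscillatory coefficient \<open>c\<^sub>k(n,x)\<close>. It is only meant for \<open>k \<le> n\<close>, where the
  natural-number subtraction in the exponent is not truncated; for \<open>k > n\<close> the binomial
  factor makes it \<open>0\<close>.
\<close>

definition superosc_coeff :: "nat \<Rightarrow> nat \<Rightarrow> real \<Rightarrow> real" where
  "superosc_coeff k n x =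
     real (n choose k) * ((1 + x) / 2) ^ (n - k) * ((1 - x) / 2) ^ k"

end

theory Submission
  imports Defs
begin

text \<open>
  With \<open>p = (1 + x) / 2\<close> and \<open>q = (1 - x) / 2\<close>, the number \<open>c\<^sub>k(n,x)\<close> is the coefficient of
  \<open>z ^ k\<close> in \<open>(p + q * z) ^ n\<close>, and the recurrence compares coefficients in
  \<open>(p + q * z) ^ (n + 1) = (p + q * z) * (p + q * z) ^ n\<close>. On the level of the closed form, both
  terms on the right carry the same monomial \<open>p ^ (n + 1 - k) * q ^ k\<close> as the left-hand side, and
  what remains is Pascal's rule for the binomial factors.
\<close>

theorem theorem3p4:
  fixes x :: real and n k :: nat
  assumes "x > 1" and "k \<in> {1..n}"
  shows "superosc_coeff k (n + 1) x =
    (1 - x) / 2 * superosc_coeff (k - 1) n x + (1 + x) / 2 * superosc_coeff k n x"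
proof -
  \<comment> \<open>Parametrising by \<open>j\<close> and \<open>d\<close> removes the truncated subtractions from the exponents.\<close>
  obtain j where k: "k = Suc j"
    using assms(2) by (cases k) auto
  obtain d where n: "n = Suc j + d"
    using assms(2) k by (auto dest: le_Suc_ex)
  define p q where "p = (1 + x) / 2" and "q = (1 - x) / 2"
  have pascal: "real (Suc n choose Suc j) = real (n choose j) + real (n choose Suc j)"
    by simp
  have exponents: "Suc n - Suc j = Suc d" "n - j = Suc d" "n - Suc j = d"
    using n by auto
  have "real (Suc n choose Suc j) * p ^ Suc d * q ^ Suc j =
      q * (real (n choose j) * p ^ Suc d * q ^ j) + p * (real (n choose Suc j) * p ^ d * q ^ Suc j)"
    unfolding pascal by (simp add: algebra_simps)
  then show ?thesis
    unfolding superosc_coeff_def k Suc_eq_plus1[symmetric] diff_Suc_1 exponents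
      p_def[symmetric] q_def[symmetric] .
qed

end
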